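(* Let $G$ be a nontrivial finite group. Then the following conditions are equivalent: (a) $\mathcal{P}^\ast(G)$ is a strongly regular graph; (b) there is a prime $p$ and a positive integer $m$ such that $G$ is a $p$-group of order $p^m$ with $\exp(G)=p$ or $\exp(G)=p^m$.
   Context: For a group $G$, $\mathcal{P}^\ast(G)$ is the simple undirected graph with vertex set $G\setminus\{1\}$ in which two distinct vertices $x,y$ are adjacent if and only if $y=x^m$ or $x=y^m$ for some positive integer $m$. A strongly regular graph with parameters $(n,k,\lambda,\mu)$ is a $k$-regular graph on $n$ vertices such that each pair of adjacent vertices has exactly $\lambda$ common neighbours and each pair of distinct non-adjacent vertices has exactly $\mu$ common neighbours; a graph is strongly regular if this holds for some parameters (complete graphs and edgeless graphs are not excluded). $\exp(G)$ is the exponent of $G$. *)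

theory Defs
  imports "HOL-Algebra.Algebra" "Graph_Theory.Graph_Theory"
begin

text \<open>
  Simple undirected graphs are the symmetric digraphs (\<^locale>\<open>graph\<close>) of the Graph_Theory
  library: an undirected edge corresponds to a pair of opposite arcs, so the degree of a
  vertex is its out-degree.
\<close>

definition proper_power_graph :: "('a, 'b) monoid_scheme \<Rightarrow> 'a pair_pre_digraph" where
  "proper_power_graph G =
     \<lparr> pverts = carrier G - {\<one>\<^bsub>G\<^esub>},
       parcs = {(x, y). x \<in> carrier G - {\<one>\<^bsub>G\<^esub>} \<and> y \<in> carrier G - {\<one>\<^bsub>G\<^esub>} \<and> x \<noteq> y \<and>
                  (\<exists>m::nat. 0 < m \<and> (y = x [^]\<^bsub>G\<^esub> m \<or> x = y [^]\<^bsub>G\<^esub> m))} \<rparr>"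

lemma pair_graph_proper_power_graph:
  assumes "finite (carrier G)"
  shows "pair_graph (proper_power_graph G)"
proof
  have "parcs (proper_power_graph G) \<subseteq> carrier G \<times> carrier G"
    by (auto simp: proper_power_graph_def)
  then show "finite (parcs (proper_power_graph G))"
    using assms finite_subset by blast
qed (use assms in \<open>auto simp: proper_power_graph_def symmetric_conv\<close>)

definition common_neighbours :: "('a, 'b) pre_digraph \<Rightarrow> 'a \<Rightarrow> 'a \<Rightarrow> 'a set" where
  "common_neighbours H u v = {w \<in> verts H. u \<rightarrow>\<^bsub>H\<^esub> w \<and> v \<rightarrow>\<^bsub>H\<^esub> w}"

text \<open>
  Complete and edgeless graphs are included; for them one of the two conditions on common
  neighbours is vacuous.
\<close>

definition strongly_regular_with ::
    "('a, 'b) pre_digraph \<Rightarrow> nat \<Rightarrow> nat \<Rightarrow> nat \<Rightarrow> nat \<Rightarrow> bool" where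
  "strongly_regular_with H n k l \<mu> \<longleftrightarrow>
     graph H \<and> card (verts H) = n \<and>
     (\<forall>v \<in> verts H. out_degree H v = k) \<and>
     (\<forall>u \<in> verts H. \<forall>v \<in> verts H. u \<rightarrow>\<^bsub>H\<^esub> v \<longrightarrow> card (common_neighbours H u v) = l) \<and>
     (\<forall>u \<in> verts H. \<forall>v \<in> verts H. u \<noteq> v \<and> \<not> u \<rightarrow>\<^bsub>H\<^esub> v \<longrightarrow>
        card (common_neighbours H u v) = \<mu>)"

definition strongly_regular :: "('a, 'b) pre_digraph \<Rightarrow> bool" where
  "strongly_regular H \<longleftrightarrow> (\<exists>n k l \<mu>. strongly_regular_with H n k l \<mu>)"

text \<open>Only meaningful for groups of finite exponent, in particular for finite groups.\<close>

definition group_exponent :: "('a, 'b) monoid_scheme \<Rightarrow> nat" where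
  "group_exponent G = (LEAST n. 0 < n \<and> (\<forall>x \<in> carrier G. x [^]\<^bsub>G\<^esub> n = \<one>\<^bsub>G\<^esub>))"

end

theory Submission
  imports Defs "HOL-Number_Theory.Cong"
begin

text \<open>
  If the graph is strongly regular, let \<open>z\<close> generate a cyclic subgroup that is maximal among those
  containing a given \<open>x\<close>. The closed neighbourhood of \<open>z\<close> is \<open>\<langle>z\<rangle> - {\<one>}\<close>, so \<open>z\<close> has the same number of
  common neighbours with every other \<open>a\<close> in \<open>\<langle>z\<rangle>\<close> as with its twin \<open>z\<inverse>\<close>, namely all the rest of
  \<open>\<langle>z\<rangle>\<close>. Hence \<open>\<langle>z\<rangle> - {\<one>}\<close> is a clique, and by regularity it is a whole connected component; all
  components have the same size. A cyclic group whose graph is complete has prime power order,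
  so the exponent is a prime power \<open>p\<^sup>r\<close>, and \<open>G\<close> is a disjoint union (outside \<open>\<one>\<close>) of cyclic
  subgroups of order \<open>p\<^sup>r\<close>. If \<open>r > 1\<close>, a central \<open>x\<close> of order \<open>p\<close> lies in each of them: for a
  generator \<open>w\<close>, the elements \<open>x w\<close> and \<open>w\<close> share the nontrivial power \<open>(x w)\<^sup>p = w\<^sup>p\<close>. So there is only
  one such subgroup and \<open>G\<close> is cyclic.

  Conversely, in both cases the graph is a disjoint union of complete graphs of equal size.
\<close>

section \<open>Prime powers and actions of \<open>p\<close>-groups\<close>

lemma eq_prime_power_if_unique_prime_divisor:
  fixes n p :: nat
  assumes "Factorial_Ring.prime p" "0 < n"
    and "\<And>q. Factorial_Ring.prime q \<Longrightarrow> q dvd n \<Longrightarrow> q = p"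
  shows "\<exists>k. n = p ^ k"
proof -
  obtain k m where km: "\<not> p dvd m" "n = m * p ^ k"
    using prime_power_canonical[OF assms(1,2)] by blast
  have "m = 1"
  proof (rule ccontr)
    assume "m \<noteq> 1"
    then obtain q where "Factorial_Ring.prime q" "q dvd m" using prime_factor_nat by blast
    then show False using assms(3)[of q] km by auto
  qed
  then show ?thesis using km by auto
qed

context group_action
begin

text \<open>Orbit sizes divide \<open>p ^ m\<close>, so an orbit with more than one point
  contributes a multiple of \<open>p\<close>, and a one-point orbit contributes nothing.\<close>

lemma card_not_fixed_dvd:
  assumes "Factorial_Ring.prime (p::nat)" "order G = p ^ m" "finite E"
  shows "p dvd card {x \<in> E. \<exists>g \<in> carrier G. \<phi> g x \<noteq> x}"
proof -
  interpret group G
    using group_hom group_hom.axioms(1) by auto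
  \<comment> \<open>The indicator of the moved points turns the cardinality into a sum that can be
    split along orbits.\<close>
  define f where "f x = (if \<exists>g \<in> carrier G. \<phi> g x \<noteq> x then 1 else 0 :: nat)" for x
  have "card {x \<in> E. \<exists>g \<in> carrier G. \<phi> g x \<noteq> x} = (\<Sum>x\<in>E. f x)"
    unfolding f_def using assms(3) by (simp add: sum.If_cases Int_def)
  also have "\<dots> = (\<Sum>orb\<in>orbits G E \<phi>. \<Sum>x\<in>orb. f x)"
    using disjoint_sum[OF assms(3)] by metis
  also have "p dvd \<dots>"
  proof (rule dvd_sum)
    fix orb assume "orb \<in> orbits G E \<phi>"
    then obtain x where x: "x \<in> E" "orb = Group_Action.orbit G \<phi> x" by (auto simp: orbits_def)
    have orbE: "orb \<subseteq> E" using x element_image by (auto simp: Group_Action.orbit_def)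
    show "p dvd (\<Sum>x\<in>orb. f x)"
    \<comment> \<open>A fixed point shrinks the orbit to itself, with sum 0; otherwise every point
      counts 1 and the sum is the orbit size.\<close>
    proof (cases "\<exists>y \<in> orb. f y = 0")
      case True
      then obtain y where y: "y \<in> orb" "\<forall>g \<in> carrier G. \<phi> g y = y"
        by (auto simp: f_def split: if_splits)
      have "orb = {y}"
      proof -
        have "z = y" if "z \<in> orb" for z
        proof -
          have "z \<in> Group_Action.orbit G \<phi> y"
            using orbit_trans[of y x z] orbit_sym[of x y] that y(1) x orbE by auto
          then show ?thesis using y(2) by (auto simp: Group_Action.orbit_def)
        qed
        then show ?thesis using y(1) by blast
      qed
      then show ?thesis using y(2) by (simp add: f_def)
    next
      case False
      then have f1: "f y = 1" if "y \<in> orb" for y using that by (auto simp: f_def split: if_splits)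
      have "x \<in> orb" using x orbit_refl by simp
      have "card orb \<noteq> 1"
      proof
        assume "card orb = 1"
        then obtain y where "orb = {y}" using card_1_singletonE by blast
        then have "orb = {x}" using \<open>x \<in> orb\<close> by simp
        then have "\<forall>g\<in>carrier G. \<phi> g x = x" using x(2) by (auto simp: Group_Action.orbit_def)
        then show False using f1[OF \<open>x \<in> orb\<close>] by (simp add: f_def)
      qed
      moreover have "card orb dvd p ^ m"
        using orbit_stabilizer_theorem[OF x(1)] x(2) assms(2) by (metis dvd_triv_left)
      ultimately have "p dvd card orb"
        using assms(1) divides_primepow_nat[of p "card orb" m]
        by (metis dvd_power gr0I power_0)
      then show ?thesis using f1 by simp
    qed
  qed
  finally show ?thesis .
qed

end

section \<open>Finite \<open>p\<close>-groups and the exponent\<close>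

context group
begin

text \<open>Under conjugation the moved points are the non-central elements. A trivial centre would
  make their number \<open>p ^ m - 1\<close> a multiple of \<open>p\<close>.\<close>

lemma p_group_nontrivial_center:
  assumes "Factorial_Ring.prime (p::nat)" "order G = p ^ m" "0 < m"
  shows "\<exists>x \<in> carrier G - {\<one>}. \<forall>g \<in> carrier G. g \<otimes> x = x \<otimes> g"
proof (rule ccontr)
  assume H: "\<not> ?thesis"
  have p: "p > 1" using assms(1) prime_gt_1_nat by blast
  have fin: "finite (carrier G)"
    using order_gt_0_iff_finite assms(2) p by simp
  interpret conj: group_action G "carrier G" "\<lambda>g. \<lambda>h \<in> carrier G. g \<otimes> h \<otimes> inv g"
    using action_by_conjugation .
  have "g \<otimes> x \<otimes> inv g = x \<longleftrightarrow> g \<otimes> x = x \<otimes> g" if "g \<in> carrier G" "x \<in> carrier G" for g x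
    using that by (metis inv_solve_right' m_closed inv_solve_right)
  then have "{x \<in> carrier G. \<exists>g \<in> carrier G. (\<lambda>h \<in> carrier G. g \<otimes> h \<otimes> inv g) x \<noteq> x} =
    carrier G - {\<one>}"
    using H by auto
  then have "p dvd card (carrier G - {\<one>})"
    using conj.card_not_fixed_dvd[OF assms(1,2) fin] by simp
  moreover have "card (carrier G - {\<one>}) = p ^ m - 1"
    using fin assms(2) by (simp add: order_def)
  ultimately have "p dvd p ^ m - (p ^ m - 1)"
    using assms(3) by (metis dvd_diff_nat dvd_power)
  then show False using p by simp
qed

lemma order_prime_power_if_exponent_prime_power:
  assumes "finite (carrier G)" "Factorial_Ring.prime (p::nat)"
    and "\<And>x. x \<in> carrier G \<Longrightarrow> x [^] (p ^ r) = \<one>"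
  shows "\<exists>m. order G = p ^ m"
proof -
  have "q = p" if q: "Factorial_Ring.prime q" "q dvd order G" for q
  proof -
    \<comment> \<open>Sylow's theorem with exponent 1 serves as Cauchy's theorem: it leads to an
      element of order \<open>q\<close>, and \<open>q\<close> then divides
      \<open>p ^ r\<close>.\<close>
    obtain k where "order G = q ^ 1 * k" using q by auto
    then obtain S where S: "subgroup S G" "card S = q"
      using sylow_thm[of q G 1 k] q(1) is_group assms(1) by auto
    interpret S: group "G\<lparr>carrier := S\<rparr>" using S(1) by (rule subgroup_imp_group)
    have "finite S" using S(1) assms(1) subgroup.subset finite_subset by blast
    have "\<one> \<in> S" using S(1) subgroup.one_closed by blast
    have "S \<noteq> {\<one>}" using S(2) prime_gt_1_nat[OF q(1)] by (intro notI) simp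
    then obtain x where x: "x \<in> S" "x \<noteq> \<one>" using \<open>\<one> \<in> S\<close> by blast
    have xG: "x \<in> carrier G" using S(1) x(1) by (rule subgroup.mem_carrier)
    have "x [^] q = \<one>"
      using S.pow_order_eq_1[of x] x(1) S(2) by (simp add: order_def flip: nat_pow_consistent)
    then have "ord x dvd q" using pow_eq_id[OF xG] by simp
    moreover have "ord x \<noteq> 1" using ord_eq_1[OF xG] x(2) by simp
    ultimately have "ord x = q" using q(1) prime_nat_iff by blast
    then have "q dvd p ^ r" using assms(3)[OF xG] pow_eq_id[OF xG] by simp
    then show ?thesis using q(1) assms(2) prime_dvd_power primes_dvd_imp_eq by blast
  qed
  moreover have "0 < order G" using order_gt_0_iff_finite assms(1) by simp
  ultimately show ?thesis
    using eq_prime_power_if_unique_prime_divisor assms(2) by blast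
qed

lemma group_exponent_eqI:
  assumes "0 < n" "\<And>x. x \<in> carrier G \<Longrightarrow> x [^] n = \<one>" "z \<in> carrier G" "ord z = n"
  shows "group_exponent G = n"
  unfolding group_exponent_def
proof (rule Least_equality)
  fix k :: nat assume "0 < k \<and> (\<forall>x\<in>carrier G. x [^] k = \<one>)"
  then show "n \<le> k" using assms(3,4) pow_eq_id by (metis dvd_imp_le)
qed (use assms in auto)

lemma group_exponent:
  assumes "finite (carrier G)"
  shows "0 < group_exponent G" "\<And>x. x \<in> carrier G \<Longrightarrow> x [^] group_exponent G = \<one>"
proof -
  \<comment> \<open>By Lagrange the group order is a candidate, so the \<open>LEAST\<close> is
    attained.\<close>
  have "0 < order G \<and> (\<forall>x \<in> carrier G. x [^] order G = \<one>)"
    using order_gt_0_iff_finite assms pow_order_eq_1 by blast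
  then have "0 < group_exponent G \<and> (\<forall>x \<in> carrier G. x [^] group_exponent G = \<one>)"
    unfolding group_exponent_def by (rule LeastI)
  then show "0 < group_exponent G" "\<And>x. x \<in> carrier G \<Longrightarrow> x [^] group_exponent G = \<one>"
    by auto
qed

lemma group_exponent_le:
  assumes "0 < n" "\<And>x. x \<in> carrier G \<Longrightarrow> x [^] n = \<one>"
  shows "group_exponent G \<le> n"
  unfolding group_exponent_def using assms by (intro Least_le) auto

text \<open>Cyclic subgroups stand in for positive powers, which agree with them in a finite group.
  Keeping a vertex in its own neighbourhood lets cliques be expressed as equality of
  neighbourhoods.\<close>

definition closed_neighbourhood :: "'a \<Rightarrow> 'a set" where
  "closed_neighbourhood x =
     {y \<in> carrier G - {\<one>}. y \<in> generate G {x} \<or> x \<in> generate G {y}}"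

end

section \<open>Cyclic subgroups of a finite group\<close>

locale finite_group = group +
  assumes fin: "finite (carrier G)"
begin

lemma mem_generate_iff:
  assumes "x \<in> carrier G"
  shows "y \<in> generate G {x} \<longleftrightarrow> (\<exists>m::nat. 0 < m \<and> y = x [^] m)"
proof
  assume "y \<in> generate G {x}"
  then obtain k :: nat where k: "y = x [^] k"
    using generate_pow_on_finite_carrier[OF fin assms] by auto
  \<comment> \<open>Adding \<open>ord x\<close> makes the exponent positive, even for
    \<open>k = 0\<close>, and leaves the power unchanged.\<close>
  have "y = x [^] (k + ord x)"
    using k assms by (simp flip: nat_pow_mult)
  then show "\<exists>m::nat. 0 < m \<and> y = x [^] m"
    using ord_ge_1[OF fin assms] by (intro exI[of _ "k + ord x"]) auto
qed (use generate_pow_on_finite_carrier[OF fin assms] in auto)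

lemma pow_mem_generate: "x \<in> carrier G \<Longrightarrow> x [^] (n::nat) \<in> generate G {x}"
  using generate_pow_on_finite_carrier[OF fin] by blast

lemma generate_sub_carrier: "x \<in> carrier G \<Longrightarrow> generate G {x} \<subseteq> carrier G"
  using generate_in_carrier by blast

lemma self_in_generate: "x \<in> generate G {x}"
  by (simp add: generate.incl)

lemma generate_mono: "x \<in> generate G {y} \<Longrightarrow> y \<in> carrier G \<Longrightarrow> generate G {x} \<subseteq> generate G {y}"
  using generate_subgroup_incl[of "{x}" "generate G {y}"] generate_is_subgroup[of "{y}"] by simp

lemma generate_eqI:
  assumes "x \<in> generate G {y}" "y \<in> carrier G" "ord x = ord y"
  shows "generate G {x} = generate G {y}"
proof (rule card_subset_eq)
  show "finite (generate G {y})"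
    using generate_sub_carrier assms(2) fin finite_subset by blast
  have "x \<in> carrier G" using assms generate_sub_carrier by blast
  then show "card (generate G {x}) = card (generate G {y})"
    using generate_pow_card assms(2,3) by metis
qed (use assms generate_mono in auto)

lemma ord_dvd_if_mem_generate:
  assumes "x \<in> generate G {y}" "y \<in> carrier G"
  shows "ord x dvd ord y"
proof -
  obtain m :: nat where m: "x = y [^] m" using mem_generate_iff assms by blast
  have "y [^] (m * ord y) = \<one>" using pow_eq_id[OF assms(2)] by simp
  then have "x [^] ord y = \<one>" using m assms(2) by (simp add: nat_pow_pow)
  then show ?thesis using pow_eq_id[of x] m assms(2) by simp
qed

lemma card_generate_minus_one:
  assumes "x \<in> carrier G"
  shows "card (generate G {x} - {\<one>}) = ord x - 1"
proof -
  have "finite (generate G {x})"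
    using generate_sub_carrier assms fin finite_subset by blast
  then show ?thesis
    using generate_pow_card[OF assms] generate.one[of G "{x}"] by (simp add: card_Diff_singleton)
qed

section \<open>Closed neighbourhoods in the power graph\<close>

abbreviation "V \<equiv> carrier G - {\<one>}"
abbreviation "N \<equiv> closed_neighbourhood"

lemma finite_N [simp]: "finite (N x)"
  using fin by (simp add: closed_neighbourhood_def)

lemma N_refl: "x \<in> V \<Longrightarrow> x \<in> N x"
  by (simp add: closed_neighbourhood_def self_in_generate)

lemma N_sym: "x \<in> V \<Longrightarrow> y \<in> N x \<Longrightarrow> x \<in> N y"
  by (auto simp: closed_neighbourhood_def)

lemma N_sub: "N x \<subseteq> V"
  by (auto simp: closed_neighbourhood_def)

lemma dominates_power_graph_iff:
  "u \<rightarrow>\<^bsub>with_proj (proper_power_graph G)\<^esub> v \<longleftrightarrow> u \<in> V \<and> u \<noteq> v \<and> v \<in> N u"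
proof -
  have "u \<rightarrow>\<^bsub>with_proj (proper_power_graph G)\<^esub> v \<longleftrightarrow> u \<in> V \<and> v \<in> V \<and> u \<noteq> v \<and>
          (\<exists>m::nat. 0 < m \<and> (v = u [^] m \<or> u = v [^] m))"
    by (simp add: proper_power_graph_def)
  also have "\<dots> \<longleftrightarrow> u \<in> V \<and> u \<noteq> v \<and> v \<in> N u"
    using mem_generate_iff[of u v] mem_generate_iff[of v u]
    unfolding closed_neighbourhood_def by blast
  finally show ?thesis .
qed

lemma verts_power_graph: "verts (with_proj (proper_power_graph G)) = V"
  by (simp add: proper_power_graph_def)

lemma out_degree_power_graph:
  assumes "u \<in> V"
  shows "out_degree (with_proj (proper_power_graph G)) u = card (N u) - 1"
proof -
  have arc: "(u, v) \<in> parcs (proper_power_graph G) \<longleftrightarrow> v \<in> N u - {u}" for v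
    using dominates_power_graph_iff[of u v] assms by auto
  have "out_arcs (with_proj (proper_power_graph G)) u =
      {(u, v) | v. (u, v) \<in> parcs (proper_power_graph G)}"
    unfolding out_arcs_def by auto
  also have "\<dots> = Pair u ` (N u - {u})"
    unfolding arc by blast
  finally have "out_arcs (with_proj (proper_power_graph G)) u = Pair u ` (N u - {u})" .
  then have "out_degree (with_proj (proper_power_graph G)) u = card (N u - {u})"
    by (simp add: out_degree_def card_image inj_on_def)
  then show ?thesis using N_refl[OF assms] by simp
qed

lemma common_neighbours_power_graph:
  assumes "u \<in> V" "v \<in> V"
  shows "common_neighbours (with_proj (proper_power_graph G)) u v = N u \<inter> N v - {u, v}"
  using assms N_sub[of u]
  unfolding common_neighbours_def dominates_power_graph_iff verts_power_graph by blast

text \<open>The hypotheses describe a disjoint union of complete graphs on \<open>c\<close> vertices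
  each.\<close>

lemma strongly_regular_if_cliques:
  assumes "\<And>u v. u \<in> V \<Longrightarrow> v \<in> N u \<Longrightarrow> N v = N u"
    and "\<And>u. u \<in> V \<Longrightarrow> card (N u) = c"
  shows "strongly_regular (with_proj (proper_power_graph G))"
proof -
  interpret P: pair_graph "proper_power_graph G"
    using pair_graph_proper_power_graph fin .
  have g: "graph (with_proj (proper_power_graph G))" by unfold_locales
  have adj: "card (N u \<inter> N v - {u, v}) = c - 2" if "u \<in> V" "u \<noteq> v" "v \<in> N u" for u v
  proof -
    have "N u \<inter> N v - {u, v} = N u - {u, v}" using assms(1) that by auto
    moreover have "card (N u - {u, v}) = card (N u) - card {u, v}"
      using that N_refl by (intro card_Diff_subset) auto
    ultimately show ?thesis using assms(2) that by simp
  qed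
  have nadj: "N u \<inter> N v - {u, v} = {}" if "u \<in> V" "v \<in> V" "v \<notin> N u" for u v
    using that assms(1) N_refl by blast
  \<comment> \<open>Vertices in different cliques share nothing, hence \<open>\<mu> = 0\<close>. For
    \<open>c = 1\<close> the value \<open>c - 2\<close> truncates to 0, but then no two vertices are
    adjacent.\<close>
  have "strongly_regular_with (with_proj (proper_power_graph G)) (card V) (c - 1) (c - 2) 0"
    unfolding strongly_regular_with_def verts_power_graph dominates_power_graph_iff
  proof (intro conjI ballI impI)
    fix u v assume uv: "u \<in> V" "v \<in> V" "u \<noteq> v \<and> \<not> (u \<in> V \<and> u \<noteq> v \<and> v \<in> N u)"
    then have "v \<notin> N u" by blast
    then show "card (common_neighbours (with_proj (proper_power_graph G)) u v) = 0"
      using nadj uv common_neighbours_power_graph by (metis card.empty)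
  qed (use g adj assms(2) out_degree_power_graph common_neighbours_power_graph in auto)
  then show ?thesis unfolding strongly_regular_def by blast
qed

section \<open>From strong regularity to the structure of the group\<close>

lemma N_eq_generate_if_maximal:
  assumes "z \<in> V" "\<And>y. y \<in> V \<Longrightarrow> z \<in> generate G {y} \<Longrightarrow> ord y \<le> ord z"
  shows "N z = generate G {z} - {\<one>}"
proof -
  \<comment> \<open>A cyclic subgroup containing \<open>z\<close> is at least as large as that of
    \<open>z\<close>; by maximality the two coincide.\<close>
  have "y \<in> generate G {z}" if y: "y \<in> V" "z \<in> generate G {y}" for y
  proof -
    have "ord z \<le> ord y"
      using generate_mono[OF y(2)] y(1) assms(1) generate_pow_card generate_sub_carrier fin
      by (metis DiffD1 card_mono finite_subset)
    then have "ord z = ord y" using assms(2)[OF y] by simp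
    then have "generate G {z} = generate G {y}"
      using generate_eqI[OF y(2)] y(1) by blast
    then show ?thesis using self_in_generate by blast
  qed
  then show ?thesis
    using assms(1) generate_sub_carrier by (auto simp: closed_neighbourhood_def)
qed

text \<open>As \<open>N\<close> is the closed neighbourhood, the last clause makes the nontrivial
  part of the subgroup both complete and an entire connected component.\<close>

definition generates_clique :: "nat \<Rightarrow> 'a \<Rightarrow> bool" where
  "generates_clique e z \<longleftrightarrow> z \<in> V \<and> ord z = e \<and>
     (\<forall>a \<in> generate G {z} - {\<one>}. N a = generate G {z} - {\<one>})"

lemma strongly_regular_imp_cliques:
  assumes "strongly_regular (with_proj (proper_power_graph G))" "V \<noteq> {}"
  shows "\<exists>e>1. \<forall>x \<in> V. \<exists>z. generates_clique e z \<and> x \<in> generate G {z}"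
proof -
  obtain n k l \<mu> where "strongly_regular_with (with_proj (proper_power_graph G)) n k l \<mu>"
    using assms(1) unfolding strongly_regular_def by blast
  then have deg: "\<And>v. v \<in> V \<Longrightarrow> card (N v) - 1 = k"
    and adj: "\<And>u v. u \<in> V \<Longrightarrow> v \<in> V \<Longrightarrow> u \<noteq> v \<Longrightarrow> v \<in> N u \<Longrightarrow> card (N u \<inter> N v - {u, v}) = l"
    unfolding strongly_regular_with_def verts_power_graph dominates_power_graph_iff
    using out_degree_power_graph by (auto simp: common_neighbours_power_graph)
  have cardN: "card (N v) = k + 1" if "v \<in> V" for v
    using deg[OF that] N_refl[OF that] card_gt_0_iff[of "N v"] by auto
  have "\<exists>z. generates_clique (k + 2) z \<and> x \<in> generate G {z}" if x: "x \<in> V" for x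
  proof -
    \<comment> \<open>Element orders are bounded by the group order, so some \<open>z\<close> has
      the greatest order among those whose cyclic subgroup contains \<open>x\<close>.\<close>
    have "\<exists>z. (z \<in> V \<and> x \<in> generate G {z}) \<and> (\<forall>y. y \<in> V \<and> x \<in> generate G {y} \<longrightarrow> ord y \<le> ord z)"
      by (rule ex_has_greatest_nat[of _ x _ "Suc (order G)"])
        (use x self_in_generate ord_le_group_order[OF fin] in \<open>auto simp: less_Suc_eq_le\<close>)
    then obtain z where z: "z \<in> V" "x \<in> generate G {z}"
      and max: "\<And>y. y \<in> V \<Longrightarrow> x \<in> generate G {y} \<Longrightarrow> ord y \<le> ord z" by blast
    have Nz: "N z = generate G {z} - {\<one>}"
      using z max generate_mono by (intro N_eq_generate_if_maximal) blast+
    \<comment> \<open>\<open>N z\<close> has \<open>ord z - 1\<close> elements by its shape and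
      \<open>k + 1\<close> by regularity: this is the source of \<open>k + 2\<close>.\<close>
    have "ord z \<noteq> 0" using ord_ge_1[OF fin] z(1) by fastforce
    then have ordz: "ord z = k + 2"
      using cardN[OF z(1)] card_generate_minus_one[of z] z(1) Nz by auto
    have "N a = N z" if a: "a \<in> N z" for a
    proof (cases "a = z")
      case False
      have aV: "a \<in> V" using a N_sub by blast
      \<comment> \<open>The inverse generates the same subgroup, so it is a twin of \<open>z\<close>
        with the same closed neighbourhood.\<close>
      define z' where "z' = inv z"
      have z'g: "z' \<in> generate G {z}"
        unfolding z'_def using generate.inv[of z "{z}" G] by simp
      have gz': "generate G {z'} = generate G {z}"
        using generate_eqI[OF z'g] z(1) by (simp add: z'_def)
      have z'V: "z' \<in> V" using z(1) by (auto simp: z'_def)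
      have Nz': "N z' = N z"
        unfolding Nz gz'[symmetric]
        by (rule N_eq_generate_if_maximal[OF z'V])
           (metis (no_types, lifting) DiffD1 gz' generate_mono max subset_iff z(2) ord_inv z(1) z'_def)
      \<comment> \<open>A second element \<open>a\<close> in \<open>N z\<close> forces
        \<open>ord z > 2\<close>, which makes \<open>z\<close> differ from its inverse.\<close>
      have "k + 2 > 2"
      proof (rule ccontr)
        assume "\<not> k + 2 > 2"
        then have "card (N z) = 1" using cardN[OF z(1)] by simp
        then show False using a N_refl[OF z(1)] False by (metis card_1_singletonE singletonD)
      qed
      have "z' \<noteq> z"
      proof
        assume "z' = z"
        then have "z [^] (2::nat) = \<one>"
          using z(1) r_inv[of z] by (simp add: z'_def numeral_2_eq_2)
        then have "ord z dvd 2" using pow_eq_id z(1) by blast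
        then have "ord z \<le> 2" by (rule dvd_imp_le) simp
        then show False using ordz \<open>k + 2 > 2\<close> by simp
      qed
      have "z' \<in> N z" using N_refl[OF z'V] Nz' by simp
      \<comment> \<open>The twin shows that \<open>l\<close> is \<open>card (N z) - 2\<close>, the
        most any neighbour of \<open>z\<close> can share with it. So \<open>a\<close> attains this
        bound and is adjacent to all the rest of \<open>N z\<close>.\<close>
      have "l = card (N z - {z, z'})"
        using adj[OF z(1) z'V] \<open>z' \<noteq> z\<close> \<open>z' \<in> N z\<close> Nz' by simp
      also have "\<dots> = card (N z) - 2"
        using \<open>z' \<in> N z\<close> N_refl[OF z(1)] \<open>z' \<noteq> z\<close> by (simp add: card_Diff_subset)
      also have "\<dots> = card (N z - {z, a})"
        using a N_refl[OF z(1)] False by (simp add: card_Diff_subset)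
      finally have "card (N z \<inter> N a - {z, a}) = card (N z - {z, a})"
        using adj[OF z(1) aV] False a by simp
      then have "N z \<inter> N a - {z, a} = N z - {z, a}"
        by (intro card_subset_eq) auto
      then have "N z \<subseteq> N a"
        using N_refl[OF aV] N_sym[OF z(1) a] by blast
      \<comment> \<open>Regularity turns the inclusion into equality.\<close>
      then have "N z = N a"
        using cardN[OF z(1)] cardN[OF aV] by (intro card_subset_eq) auto
      then show ?thesis by simp
    qed simp
    then show ?thesis using z ordz Nz unfolding generates_clique_def by blast
  qed
  then show ?thesis by (intro exI[of _ "k + 2"]) simp
qed

lemma strongly_regular_imp:
  assumes "strongly_regular (with_proj (proper_power_graph G))" "V \<noteq> {}"
  shows "\<exists>p m :: nat. Factorial_Ring.prime p \<and> 0 < m \<and> order G = p ^ m \<and>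
       (group_exponent G = p \<or> group_exponent G = p ^ m)"
proof -
  obtain e where e: "e > 1" and
    clique: "\<And>x. x \<in> V \<Longrightarrow> \<exists>z. generates_clique e z \<and> x \<in> generate G {z}"
    using strongly_regular_imp_cliques[OF assms] by blast
  obtain z where cz: "generates_clique e z" using clique assms(2) by blast
  have z: "z \<in> V" "ord z = e" using cz unfolding generates_clique_def by blast+
  have pow_ord: "\<exists>y \<in> generate G {z} - {\<one>}. ord y = q" if q: "Factorial_Ring.prime q" "q dvd e" for q
  proof -
    \<comment> \<open>The witness of order \<open>q\<close> is \<open>z [^] k\<close> with the
      cofactor \<open>k\<close>.\<close>
    obtain k where k: "e = q * k" using q by blast
    then have "k \<noteq> 0" using e by (intro notI) simp
    have "z [^] k \<in> generate G {z}" using pow_mem_generate z(1) by simp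
    moreover have oq: "ord (z [^] k) = q" using ord_pow[of z k] z k \<open>k \<noteq> 0\<close> by simp
    moreover have "z [^] k \<noteq> \<one>" using oq q(1) by (metis ord_id not_prime_1)
    ultimately show ?thesis by blast
  qed
  obtain p where p: "Factorial_Ring.prime p" "p dvd e"
    using e prime_factor_nat[of e] by auto
  have uniq: "q = p" if q: "Factorial_Ring.prime q" "q dvd e" for q
  proof -
    obtain y where y: "y \<in> generate G {z} - {\<one>}" "ord y = q" using pow_ord q by blast
    obtain x where x: "x \<in> generate G {z} - {\<one>}" "ord x = p" using pow_ord p by blast
    have C: "x \<in> carrier G" "y \<in> carrier G" using x y z(1) generate_sub_carrier by blast+
    \<comment> \<open>Inside a clique one of \<open>x\<close>, \<open>y\<close> is a power of the
      other, so one of the two prime orders divides the other.\<close>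
    have "y \<in> N x" using cz x(1) y(1) unfolding generates_clique_def by blast
    then have "q dvd p \<or> p dvd q"
      unfolding closed_neighbourhood_def using ord_dvd_if_mem_generate x(2) y(2) C by blast
    then show ?thesis using p q primes_dvd_imp_eq by blast
  qed
  obtain r where r: "e = p ^ r"
    using eq_prime_power_if_unique_prime_divisor[OF p(1), of e] e uniq by auto
  have exp1: "x [^] e = \<one>" if "x \<in> carrier G" for x
  proof (cases "x = \<one>")
    case False
    then have "x \<in> V" using that by blast
    then obtain w where w: "generates_clique e w" "x \<in> generate G {w}" using clique by blast
    then have "ord x dvd e"
      using ord_dvd_if_mem_generate[of x w] unfolding generates_clique_def by blast
    then show ?thesis using pow_eq_id that by blast
  qed simp
  have expG: "group_exponent G = e"
    using group_exponent_eqI[of e z] e exp1 z by auto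
  obtain m where m: "order G = p ^ m"
    using order_prime_power_if_exponent_prime_power[OF fin p(1), of r] exp1 r by blast
  have "m \<noteq> 0"
  proof
    assume "m = 0"
    then have "order G = 1" using m by simp
    then have "carrier G = {\<one>}" using order_one_triv_iff by blast
    then show False using assms(2) by simp
  qed
  \<comment> \<open>If both alternatives fail, then \<open>p < e\<close> and each clique misses some
    nontrivial element; a central element of order \<open>p\<close> will force two supposedly
    distinct cliques to meet.\<close>
  have "r = 1 \<or> e = order G"
  proof (rule ccontr)
    assume H: "\<not> (r = 1 \<or> e = order G)"
    have "r \<noteq> 0" using r e by (metis less_irrefl power_0)
    then have r2: "p < e" using H r p(1) by (metis One_nat_def less_one linorder_neqE_nat
         power_one_right power_strict_increasing_iff prime_gt_1_nat)
    obtain c where c: "c \<in> V" "\<And>g. g \<in> carrier G \<Longrightarrow> g \<otimes> c = c \<otimes> g"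
      using p_group_nontrivial_center[OF p(1) m] \<open>m \<noteq> 0\<close> by blast
    have "ord c dvd p ^ m" using ord_dvd_group_order c(1) m by auto
    moreover have "ord c \<noteq> 1" using c(1) ord_eq_1 by blast
    ultimately have "p dvd ord c" using p(1) divides_primepow_nat[of p "ord c" m]
        by (metis dvd_power gr0I power_0)
    then obtain k where k: "ord c = p * k" by blast
    have "k \<noteq> 0" using k c(1) ord_ge_1[OF fin, of c] by auto
    \<comment> \<open>Since \<open>ord c = p * k\<close>, this power has order \<open>p\<close>, and
      it is still central.\<close>
    define x where "x = c [^] k"
    have xC: "x \<in> carrier G" using c(1) by (simp add: x_def)
    have ordx: "ord x = p" using ord_pow[of c k] c(1) k \<open>k \<noteq> 0\<close> by (simp add: x_def)
    have xV: "x \<in> V" using ordx xC p(1) by (metis DiffI ord_id not_prime_1 singletonD)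
    have comm: "x \<otimes> g = g \<otimes> x" if "g \<in> carrier G" for g
      using group_commutes_pow[of c g k] that c unfolding x_def by auto
    obtain u where cu: "generates_clique e u" and xu: "x \<in> generate G {u}"
      using clique[OF xV] by blast
    have u: "u \<in> V" "ord u = e" using cu unfolding generates_clique_def by blast+
    \<comment> \<open>The clique of \<open>u\<close> contains \<open>x\<close>; the aim is that the
      clique of \<open>w\<close>, which contains the outside element \<open>y\<close>, contains
      \<open>x\<close> too.\<close>
    have "generate G {u} \<noteq> carrier G"
      using H u generate_pow_card[of u] by (auto simp: order_def)
    then obtain y where y: "y \<in> carrier G" "y \<notin> generate G {u}"
      using generate_sub_carrier u(1) by blast
    have yV: "y \<in> V" using y generate.one[of G "{u}"] by auto
    then obtain w where cw: "generates_clique e w" and yw: "y \<in> generate G {w}"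
      using clique by blast
    have w: "w \<in> V" "ord w = e"
      and Nw: "\<And>a. a \<in> generate G {w} \<Longrightarrow> a \<noteq> \<one> \<Longrightarrow> N a = generate G {w} - {\<one>}"
      using cw unfolding generates_clique_def by blast+
    have p0: "0 < p" using p(1) prime_gt_0_nat by blast
    have wp: "w [^] p \<in> generate G {w}" using pow_mem_generate w(1) by simp
    have "\<not> e dvd p" using r2 p0 by (auto dest: dvd_imp_le)
    then have wp1: "w [^] p \<noteq> \<one>" using pow_eq_id[of w p] w by blast
    \<comment> \<open>Centrality lets the power distribute, and \<open>x [^] p\<close> vanishes. The
      common power \<open>w [^] p\<close> is nontrivial because \<open>p < e\<close>, so it links
      \<open>x \<otimes> w\<close> to the clique of \<open>w\<close>.\<close>
    have "(x \<otimes> w) [^] p = x [^] p \<otimes> w [^] p"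
      using pow_mult_distrib comm w(1) xC by blast
    also have "\<dots> = w [^] p" using ordx xC w(1) by (metis DiffD1 l_one nat_pow_closed pow_ord_eq_1)
    finally have xwp: "(x \<otimes> w) [^] p = w [^] p" .
    have xwC: "x \<otimes> w \<in> carrier G" using xC w(1) by simp
    have "w [^] p \<in> generate G {x \<otimes> w}"
      using pow_mem_generate[OF xwC, of p] xwp by simp
    moreover have "x \<otimes> w \<noteq> \<one>" using xwp wp1 by (metis nat_pow_one)
    ultimately have "x \<otimes> w \<in> N (w [^] p)"
      using xwC by (simp add: closed_neighbourhood_def)
    then have xw: "x \<otimes> w \<in> generate G {w}" using Nw[OF wp wp1] by blast
    have sub: "subgroup (generate G {w}) G" using generate_is_subgroup w(1) by auto
    have "(x \<otimes> w) \<otimes> inv w \<in> generate G {w}"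
      using sub xw self_in_generate subgroup.m_closed subgroup.m_inv_closed by metis
    then have "x \<in> generate G {w}" using xC w(1) by (simp add: m_assoc)
    \<comment> \<open>Both sides equal \<open>N x\<close>.\<close>
    then have "generate G {w} - {\<one>} = generate G {u} - {\<one>}"
      using Nw[of x] cu xu xV unfolding generates_clique_def by blast
    then have "y \<in> generate G {u}" using yw yV by blast
    then show False using y(2) by blast
  qed
  then show ?thesis using p(1) m \<open>m \<noteq> 0\<close> expG r by (metis gr0I power_one_right)
qed

section \<open>The two families of groups with strongly regular graph\<close>

lemma prime_exponent_imp:
  assumes "Factorial_Ring.prime (p::nat)" "group_exponent G = p"
  shows "strongly_regular (with_proj (proper_power_graph G))"
proof -
  have ord: "ord x = p" if "x \<in> V" for x
  proof -
    have "ord x dvd p" using group_exponent(2)[OF fin] assms(2) that pow_eq_id by auto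
    moreover have "ord x \<noteq> 1" using that ord_eq_1 by blast
    ultimately show ?thesis using assms(1) prime_nat_iff by blast
  qed
  have gen: "generate G {x} = generate G {y}" if "x \<in> V" "y \<in> V" "x \<in> generate G {y}" for x y
    using generate_eqI[OF that(3)] ord that by simp
  \<comment> \<open>All vertices have order \<open>p\<close>, so each is maximal and its clique has
    \<open>p - 1\<close> vertices.\<close>
  have N: "N x = generate G {x} - {\<one>}" if "x \<in> V" for x
    using that by (rule N_eq_generate_if_maximal) (simp only: ord that order.refl)
  show ?thesis
  proof (rule strongly_regular_if_cliques)
    show "N v = N u" if "u \<in> V" "v \<in> N u" for u v
    proof -
      have "v \<in> V" using that(2) N_sub by blast
      moreover have "v \<in> generate G {u}" using that N by blast
      ultimately show ?thesis using gen[of v u] N[of u] N[of v] that(1) by metis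
    qed
    show "card (N u) = p - 1" if "u \<in> V" for u
      using N[OF that] card_generate_minus_one[of u] ord[OF that] that by simp
  qed
qed

text \<open>The exponent forces \<open>G\<close> to be cyclic. The subgroups of a cyclic
  \<open>p\<close>-group form a chain, so the graph is complete.\<close>

lemma cyclic_p_group_imp:
  assumes "Factorial_Ring.prime (p::nat)" "0 < m" "order G = p ^ m" "group_exponent G = p ^ m"
  shows "strongly_regular (with_proj (proper_power_graph G))"
proof -
  have "\<exists>z \<in> carrier G. ord z = p ^ m"
  proof (rule ccontr)
    assume H: "\<not> ?thesis"
    \<comment> \<open>Without an element of order \<open>p ^ m\<close>, every order divides
      \<open>p ^ (m - 1)\<close>, which contradicts the minimality of the exponent.\<close>
    have "x [^] (p ^ (m - 1)) = \<one>" if x: "x \<in> carrier G" for x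
    proof -
      have "ord x dvd p ^ m" using ord_dvd_group_order x assms(3) by auto
      then obtain i where i: "i \<le> m" "ord x = p ^ i" using divides_primepow_nat assms(1) by blast
      then have "i \<le> m - 1" using H x by (metis Suc_pred' assms(2) le_SucE)
      then have "ord x dvd p ^ (m - 1)" using i le_imp_power_dvd by metis
      then show ?thesis using pow_eq_id x by blast
    qed
    then have "p ^ m \<le> p ^ (m - 1)"
      using group_exponent_le[of "p ^ (m - 1)"] assms prime_gt_0_nat by auto
    then show False using assms(1,2) prime_gt_1_nat[of p]
      by (simp add: power_increasing_iff)
  qed
  then obtain z where z: "z \<in> carrier G" "ord z = p ^ m" by blast
  have gz: "generate G {z} = carrier G"
    using generate_pow_card[OF z(1)] z assms(3) generate_sub_carrier[OF z(1)] fin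
    by (intro card_subset_eq) (auto simp: order_def)
  \<comment> \<open>\<open>z [^] b\<close> is a power of \<open>z [^] a\<close> once
    \<open>a * k\<close> is congruent to \<open>b\<close> modulo \<open>p ^ m\<close> for some
    \<open>k\<close>; the gcd condition makes this solvable.\<close>
  have aux: "v \<in> generate G {u}"
    if gcd: "gcd a (p ^ m) dvd b" and uv: "u = z [^] a" "v = z [^] b" for u v and a b :: nat
  proof -
    obtain k where "[a * k = b] (mod p ^ m)" using cong_solve_dvd_nat[OF gcd] by (elim exE) (rule that)
    then have "int (ord z) dvd int (a * k) - int b"
      using z(2) by (metis cong_iff_dvd_diff cong_int_iff)
    then have "z [^] b = z [^] (a * k)"
      using int_pow_eq[OF z(1), of "int b" "int (a * k)"] by (simp only: int_pow_int)
    then have "v = u [^] k" using uv z(1) by (simp add: nat_pow_pow)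
    then show ?thesis using pow_mem_generate uv(1) z(1) by simp
  qed
  have N: "N u = V" if "u \<in> V" for u
  proof -
    have "v \<in> N u" if "v \<in> V" for v
    proof -
      have "u \<in> generate G {z}" "v \<in> generate G {z}"
        using \<open>u \<in> V\<close> \<open>v \<in> V\<close> gz by blast+
      then obtain a b :: nat where ab: "u = z [^] a" "v = z [^] b"
        unfolding mem_generate_iff[OF z(1)] by (elim exE conjE) (rule that)
      \<comment> \<open>Divisors of \<open>p ^ m\<close> are powers of \<open>p\<close>, so any two
        of them are comparable under divisibility.\<close>
      have "\<exists>i. gcd c (p ^ m) = p ^ i" for c
        using divides_primepow_nat[OF assms(1), of "gcd c (p ^ m)" m] by auto
      then obtain i j where ij: "gcd a (p ^ m) = p ^ i" "gcd b (p ^ m) = p ^ j" by metis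
      have "gcd a (p ^ m) dvd gcd b (p ^ m) \<or> gcd b (p ^ m) dvd gcd a (p ^ m)"
        unfolding ij using le_imp_power_dvd nat_le_linear by metis
      then have "gcd a (p ^ m) dvd b \<or> gcd b (p ^ m) dvd a" by auto
      then have "v \<in> generate G {u} \<or> u \<in> generate G {v}"
        using aux[OF _ ab] aux[OF _ ab(2,1)] by (elim disjE) simp_all
      then show ?thesis
        using \<open>u \<in> V\<close> \<open>v \<in> V\<close> unfolding closed_neighbourhood_def by blast
    qed
    then show ?thesis using N_sub by blast
  qed
  show ?thesis
    by (rule strongly_regular_if_cliques[of "card V"]) (use N in auto)
qed

end

theorem theorem3:
  fixes G :: "('a, 'b) monoid_scheme"
  assumes "group G"
    and "finite (carrier G)"
    and "carrier G \<noteq> {\<one>\<^bsub>G\<^esub>}"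
  shows "strongly_regular (with_proj (proper_power_graph G)) \<longleftrightarrow>
    (\<exists>p m :: nat. Factorial_Ring.prime p \<and> 0 < m \<and> order G = p ^ m \<and>
       (group_exponent G = p \<or> group_exponent G = p ^ m))"
proof -
  interpret group G by fact
  interpret finite_group G by unfold_locales fact
  have "V \<noteq> {}" using assms(3) one_closed by blast
  then show ?thesis
    using strongly_regular_imp prime_exponent_imp cyclic_p_group_imp by blast
qed

end
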